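(* For $x>0$, let $$\zeta_x=\frac\pi4\frac{f(x)}{\sqrt{f(x)^2-1}}\left(\frac1{2\pi^2}-\int_0^x\Theta_0(t)\,dt\right).$$ Then $x\mapsto\zeta_x$ is continuous on $(0,\infty)$ and satisfies $$\lim_{x\to0}\zeta_x=\frac1{8\pi},\qquad\lim_{x\to\infty}\zeta_x=-\infty.$$ Moreover, there exists a unique $x_0\in(0,\infty)$ such that $\zeta_x=0$ if and only if $x=x_0$.
   Context: $f:(0,\infty)\to(1,\infty)$ is the inverse of the strictly decreasing bijection $(1,\infty)\to(0,\infty)$, $y\mapsto\dfrac{\pi}{\sqrt{y^2-1}-\arccos\frac1y}$. $g(t)=\dfrac{\arccos\frac1t}{\sqrt{1-\frac1{t^2}}}$ for $t>1$. $K_1$ is the modified Bessel function of the second kind of order $1$. For $x>0$, $$\Theta_0(x)=-\frac{\pi}{8x^2}g''(f(x))\frac{f(x)}{\sqrt{f(x)^2-1}}-D(x)\,\frac2\pi\,\frac{\sqrt{f(x)^2-1}}{f(x)},\qquad D(x)=-\frac1{12x^2f(x)^2}\int_0^\infty t^3K_1(t)e^{-\frac t{f(x)}}\,dt.$$ *)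

theory Defs
  imports "HOL-Analysis.Analysis"
begin

definition h :: "real \<Rightarrow> real" where
  "h y = pi / (sqrt (y\<^sup>2 - 1) - arccos (1 / y))"

text \<open>\<open>h\<close> restricts to a strictly decreasing bijection from \<open>(1, \<infinity>)\<close> onto \<open>(0, \<infinity>)\<close>,
  so \<open>f x\<close> is meaningful precisely for \<open>x > 0\<close>.\<close>

definition f :: "real \<Rightarrow> real" where
  "f = the_inv_into {1<..} h"

definition g :: "real \<Rightarrow> real" where
  "g t = arccos (1 / t) / sqrt (1 - 1 / t\<^sup>2)"

text \<open>The modified Bessel function of the second kind of real order \<open>\<nu>\<close> at a positive real
  argument, defined by its classical integral
  \<open>K\<^sub>\<nu>(x) = \<integral>\<^sub>0\<^sup>\<infinity> exp (- x cosh t) cosh (\<nu> t) dt\<close>.\<close>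

definition Bessel_K :: "real \<Rightarrow> real \<Rightarrow> real" where
  "Bessel_K \<nu> x = (LBINT t:{0<..}. exp (- x * cosh t) * cosh (\<nu> * t))"

definition D :: "real \<Rightarrow> real" where
  "D x = - (1 / (12 * x\<^sup>2 * (f x)\<^sup>2)) * (LBINT t:{0<..}. t ^ 3 * Bessel_K 1 t * exp (- t / f x))"

definition Theta0 :: "real \<Rightarrow> real" where
  "Theta0 x = - (pi / (8 * x\<^sup>2)) * deriv (deriv g) (f x) * (f x / sqrt ((f x)\<^sup>2 - 1))
     - D x * (2 / pi) * (sqrt ((f x)\<^sup>2 - 1) / f x)"

definition zeta :: "real \<Rightarrow> real" where
  "zeta x = pi / 4 * (f x / sqrt ((f x)\<^sup>2 - 1)) * (1 / (2 * pi\<^sup>2) - (LBINT t:{0<..<x}. Theta0 t))"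

end

theory Submission
  imports Defs "HOL-Real_Asymp.Real_Asymp"
begin

text \<open>
The function \<open>\<Theta>\<^sub>0\<close> is positive and has an elementary primitive, once \<open>x\<close> is expressed by an angle.
Write \<open>f x = 1 / cos \<theta>\<close> with \<open>0 < \<theta> < pi/2\<close>. Then \<open>x = pi / (tan \<theta> - \<theta>)\<close>, the angle decreases from
\<open>pi/2\<close> to \<open>0\<close> as \<open>x\<close> runs from \<open>0\<close> to infinity, and \<open>f / sqrt (f\<^sup>2 - 1) = 1 / sin \<theta>\<close>.

The Bessel integral in \<open>D\<close> is evaluated by inserting the integral that defines \<open>K\<^sub>1\<close> and exchanging
the integrations (\<open>Bessel_K_1_moment\<close>); it becomes
\<open>6 \<integral>\<^sub>0\<^sup>\<infinity> cosh u / (cosh u + cos \<theta>)\<^sup>4 du\<close>, which is elementary (\<open>cosh_div_power4_integral\<close>). The term with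
\<open>g''\<close> is elementary too (\<open>deriv_deriv_g\<close>). Both contributions to \<open>\<Theta>\<^sub>0\<close> are nonnegative and the
first is positive, because \<open>3 sin \<theta> - sin\<^sup>3 \<theta> > 3 \<theta> cos \<theta>\<close> (\<open>Theta0_pos\<close>).

Since \<open>dx / x\<^sup>2 = - tan\<^sup>2 \<theta> d\<theta> / pi\<close>, the factor \<open>1 / x\<^sup>2\<close> disappears from \<open>\<Theta>\<^sub>0(x) dx\<close>, and what remains has
an explicit primitive in \<open>\<theta>\<close> (\<open>DERIV_primitive\<close>). So the integral \<open>M(x)\<close> of \<open>\<Theta>\<^sub>0\<close> over \<open>(0, x)\<close> is
a difference of two values of this primitive (\<open>Theta0_integral\<close>). It is continuous and strictly
increasing from \<open>0\<close> to the total mass \<open>1/24 + 2 / (9 pi\<^sup>2)\<close>.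

Now \<open>\<zeta>\<^sub>x = pi / (4 sin \<theta>) (1 / (2 pi\<^sup>2) - M(x))\<close>. Near \<open>x = 0\<close> the bracket tends to \<open>1 / (2 pi\<^sup>2)\<close> and
\<open>sin \<theta>\<close> to \<open>1\<close>. The total mass exceeds \<open>1 / (2 pi\<^sup>2)\<close>, which amounts to \<open>pi\<^sup>2 > 20/3\<close>; so for large \<open>x\<close> the
bracket is bounded away from \<open>0\<close> and negative, while \<open>1 / sin \<theta>\<close> tends to infinity. The zeros of \<open>\<zeta>\<close> are the solutions
of \<open>M(x) = 1 / (2 pi\<^sup>2)\<close>, and there is exactly one because \<open>M\<close> is strictly increasing.
\<close>

section \<open>Integrals over a half line\<close>

lemma FTC_greaterThan_nonneg:
  fixes F f :: "real \<Rightarrow> real"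
  assumes "\<And>x. a < x \<Longrightarrow> (F has_real_derivative f x) (at x)"
    and "\<And>x. a < x \<Longrightarrow> isCont f x"
    and "\<And>x. a < x \<Longrightarrow> 0 \<le> f x"
    and "(F \<longlongrightarrow> A) (at_right a)"
    and "(F \<longlongrightarrow> B) at_top"
  shows "set_integrable lborel {a<..} f" and "(LBINT x:{a<..}. f x) = B - A"
proof -
  have *: "ereal a < \<infinity>" "\<And>x. ereal a < ereal x \<Longrightarrow> ereal x < \<infinity> \<Longrightarrow> (F has_real_derivative f x) (at x)"
    "\<And>x. ereal a < ereal x \<Longrightarrow> ereal x < \<infinity> \<Longrightarrow> isCont f x"
    "AE x in lborel. ereal a < ereal x \<longrightarrow> ereal x < \<infinity> \<longrightarrow> 0 \<le> f x"
    "((F \<circ> real_of_ereal) \<longlongrightarrow> A) (at_right (ereal a))"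
    "((F \<circ> real_of_ereal) \<longlongrightarrow> B) (at_left \<infinity>)"
    using assms by (simp_all add: ereal_tendsto_simps)
  show "set_integrable lborel {a<..} f"
    using interval_integral_FTC_nonneg(1)[OF *] by simp
  show "(LBINT x:{a<..}. f x) = B - A"
    using interval_integral_FTC_nonneg(2)[OF *] by (simp add: interval_lebesgue_integral_def)
qed

lemma Laplace_transform_cube:
  fixes a :: real
  assumes "0 < a"
  shows "set_integrable lborel {0<..} (\<lambda>t. t ^ 3 * exp (- t * a))"
    and "(LBINT t:{0<..}. t ^ 3 * exp (- t * a)) = 6 / a ^ 4"
proof -
  define b where "b = 1 / a"
  have ab: "a * b = 1"
    using assms by (simp add: b_def)
  define F where "F = (\<lambda>t. - (t ^ 3 * b + 3 * t\<^sup>2 * b\<^sup>2 + 6 * t * b ^ 3 + 6 * b ^ 4) * exp (- t * a))"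
  have d: "(F has_real_derivative t ^ 3 * exp (- t * a)) (at t)" for t
  proof (rule DERIV_cong)
    show "(F has_real_derivative - (3 * t\<^sup>2 * b + 6 * t * b\<^sup>2 + 6 * b ^ 3) * exp (- t * a) - a * F t) (at t)"
      unfolding F_def by (auto intro!: derivative_eq_intros)
    show "- (3 * t\<^sup>2 * b + 6 * t * b\<^sup>2 + 6 * b ^ 3) * exp (- t * a) - a * F t = t ^ 3 * exp (- t * a)"
      unfolding F_def using ab by algebra
  qed
  have "isCont F 0"
    using d by (rule DERIV_isCont)
  then have A: "(F \<longlongrightarrow> F 0) (at_right 0)"
    by (simp add: isCont_def filterlim_at_split)
  have B: "(F \<longlongrightarrow> 0) at_top"
    unfolding F_def using assms by real_asymp
  have cont: "isCont (\<lambda>t. t ^ 3 * exp (- t * a)) t" for t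
    by (intro continuous_intros)
  note FTC = FTC_greaterThan_nonneg[OF d cont _ A B]
  show "set_integrable lborel {0<..} (\<lambda>t. t ^ 3 * exp (- t * a))"
    by (rule FTC(1)) auto
  show "(LBINT t:{0<..}. t ^ 3 * exp (- t * a)) = 6 / a ^ 4"
    by (subst FTC(2)) (auto simp: F_def b_def power_divide)
qed

section \<open>The Bessel moment in closed form\<close>

text \<open>With \<open>r = 1 / (cosh u + c)\<close> these derivatives are polynomials in \<open>r\<close>, because
\<open>cosh u = 1/r - c\<close> and \<open>sinh\<^sup>2 u = cosh\<^sup>2 u - 1\<close>. Hence the integral of a polynomial in \<open>r\<close>
without constant term reduces, by linear algebra in its coefficients, to the integral of \<open>r\<close>.\<close>

lemma DERIV_sinh_div_power:
  fixes c u :: real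
  assumes "cosh u + c > 0"
  shows "((\<lambda>u. sinh u / (cosh u + c) ^ Suc k) has_real_derivative
     (\<lambda>r. - real k * r ^ k + (2 * real k + 1) * c * r ^ Suc k + Suc k * (1 - c\<^sup>2) * r ^ Suc (Suc k))
      (1 / (cosh u + c))) (at u)"
proof (rule DERIV_cong)
  define X r where "X = cosh u + c" and "r = 1 / X"
  have X: "X \<noteq> 0" "cosh u = X - c" "(sinh u)\<^sup>2 = (X - c)\<^sup>2 - 1" "X * r = 1"
    using assms by (simp_all add: X_def r_def sinh_square_eq)
  let ?D = "(cosh u * X ^ Suc k - sinh u * (real (Suc k) * (sinh u * X ^ k))) / (X ^ Suc k * X ^ Suc k)"
  show "((\<lambda>u. sinh u / (cosh u + c) ^ Suc k) has_real_derivative ?D) (at u)"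
    unfolding X_def by (rule derivative_eq_intros refl | use assms in simp)+
  have "?D = r ^ k * (cosh u * r - (sinh u)\<^sup>2 * real (Suc k) * r\<^sup>2)"
    using X(1) by (simp add: r_def power2_eq_square right_diff_distrib diff_divide_distrib power_divide mult_ac)
  also have "cosh u * r - (sinh u)\<^sup>2 * real (Suc k) * r\<^sup>2 =
      - real k + (2 * real k + 1) * c * r + Suc k * (1 - c\<^sup>2) * r\<^sup>2"
    using X(4) unfolding X(2,3) of_nat_Suc by algebra
  also have "r ^ k * \<dots> =
      - real k * r ^ k + (2 * real k + 1) * c * r ^ Suc k + Suc k * (1 - c\<^sup>2) * r ^ Suc (Suc k)"
    by (simp add: algebra_simps power2_eq_square)
  finally show "?D = (\<lambda>r. - real k * r ^ k + (2 * real k + 1) * c * r ^ Suc k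
      + Suc k * (1 - c\<^sup>2) * r ^ Suc (Suc k)) (1 / (cosh u + c))"
    by (simp only: r_def X_def)
qed

text \<open>The value at \<open>u = 0\<close> of the arc tangent that appears in the primitive of
\<open>1 / (cosh u + cos \<theta>)\<close>.\<close>

lemma arctan_cot_half:
  assumes "0 < \<theta>" "\<theta> < pi / 2"
  shows "arctan ((1 + cos \<theta>) / sin \<theta>) = pi / 2 - \<theta> / 2"
proof (rule arctan_unique)
  have "cos \<theta> = 2 * cos (\<theta> / 2) ^ 2 - 1" "sin \<theta> = 2 * sin (\<theta> / 2) * cos (\<theta> / 2)"
    using cos_double_cos[of "\<theta> / 2"] sin_double[of "\<theta> / 2"] by simp_all
  moreover have "sin (\<theta> / 2) > 0" "cos (\<theta> / 2) > 0"
    using assms by (auto intro: sin_gt_zero cos_gt_zero)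
  moreover have "tan (pi / 2 - \<theta> / 2) = cos (\<theta> / 2) / sin (\<theta> / 2)"
    unfolding tan_def sin_diff cos_diff by simp
  ultimately show "tan (pi / 2 - \<theta> / 2) = (1 + cos \<theta>) / sin \<theta>"
    by (simp add: power2_eq_square)
qed (use assms in auto)

text \<open>The value of \<open>\<integral>\<^sub>0\<^sup>\<infinity> t\<^sup>3 K\<^sub>1(t) e\<^bsup>-t cos \<theta>\<^esup> dt\<close>, as is shown below.\<close>

definition bessel_moment :: "real \<Rightarrow> real" where
  "bessel_moment \<theta> =
     (3 * \<theta> * (1 + 4 * (cos \<theta>)\<^sup>2) - cos \<theta> * sin \<theta> * (13 + 2 * (cos \<theta>)\<^sup>2)) / sin \<theta> ^ 7"

text \<open>The integrand is \<open>6 (r\<^sup>3 - c r\<^sup>4)\<close> in terms of \<open>r = 1 / (cosh u + c)\<close> and \<open>c = cos \<theta>\<close>. A primitive is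
sought as a combination of \<open>sinh u * r\<^sup>k\<close> for \<open>k = 1, 2, 3\<close> and of the primitive
\<open>(2 / sin \<theta>) arctan ((e\<^sup>u + cos \<theta>) / sin \<theta>)\<close> of \<open>r\<close>. Comparing the coefficients of
\<open>r\<^sup>4, r\<^sup>3, r\<^sup>2, r\<close> gives a triangular system for the four unknowns. At infinity
only the terms with \<open>sinh u * r\<close> and the arc tangent survive.\<close>

lemma cosh_div_power4_integral:
  assumes \<theta>: "0 < \<theta>" "\<theta> < pi / 2"
  shows "set_integrable lborel {0<..} (\<lambda>u. 6 * cosh u / (cosh u + cos \<theta>) ^ 4)"
    and "(LBINT u:{0<..}. 6 * cosh u / (cosh u + cos \<theta>) ^ 4) = bessel_moment \<theta>"
proof -
  define c s where "c = cos \<theta>" and "s = sin \<theta>"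
  have s: "s > 0" "s\<^sup>2 = 1 - c\<^sup>2" and c: "c > 0"
    using \<theta> by (auto simp: s_def c_def sin_gt_zero cos_gt_zero sin_squared_eq)
  have X: "cosh u + c > 0" for u :: real
    using c cosh_real_pos[of u] by linarith
  define a1 a2 a3 b where "a1 = - c * (13 + 2 * c\<^sup>2) / s ^ 6" and "a2 = (3 + 2 * c\<^sup>2) / s ^ 4"
    and "a3 = - 2 * c / s\<^sup>2" and "b = (3 + 12 * c\<^sup>2) / s ^ 6"
  define F where "F = (\<lambda>u. a1 * (sinh u / (cosh u + c) ^ Suc 0) + a2 * (sinh u / (cosh u + c) ^ Suc 1)
     + a3 * (sinh u / (cosh u + c) ^ Suc 2) + b * (2 / s * arctan ((exp u + c) / s)))"
  have darct: "((\<lambda>u. 2 / s * arctan ((exp u + c) / s)) has_real_derivative 1 / (cosh u + c)) (at u)" for u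
  proof -
    have "((\<lambda>u. 2 / s * arctan ((exp u + c) / s)) has_real_derivative
        2 / s * ((exp u / s) / (1 + ((exp u + c) / s)\<^sup>2))) (at u)"
      using s by (auto intro!: derivative_eq_intros simp: divide_inverse)
    also have "1 + ((exp u + c) / s)\<^sup>2 = (s\<^sup>2 + (exp u + c)\<^sup>2) / s\<^sup>2"
      using s(1) by (simp add: power_divide add_divide_distrib[of "s\<^sup>2"])
    also have "2 / s * ((exp u / s) / ((s\<^sup>2 + (exp u + c)\<^sup>2) / s\<^sup>2)) = 2 * exp u / (s\<^sup>2 + (exp u + c)\<^sup>2)"
      using s(1) by (simp add: power2_eq_square)
    also have "s\<^sup>2 + (exp u + c)\<^sup>2 = 2 * exp u * (cosh u + c)"
      unfolding s(2) by (simp add: cosh_def field_simps power2_eq_square exp_minus)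
    finally show ?thesis using X[of u] by simp
  qed
  \<comment> \<open>the comparison of coefficients that determines \<open>a3\<close>, \<open>a2\<close>, \<open>a1\<close>, \<open>b\<close> in this order\<close>
  have key: "(a1 * (c * r + s\<^sup>2 * r\<^sup>2) + a2 * (- r + 3 * c * r\<^sup>2 + 2 * s\<^sup>2 * r ^ 3)
     + a3 * (- 2 * r\<^sup>2 + 5 * c * r ^ 3 + 3 * s\<^sup>2 * r ^ 4) + b * r) = 6 * (r ^ 3 - c * r ^ 4)" for r
  proof -
    have f: "a3 * s\<^sup>2 = - 2 * c" "a2 * s ^ 4 = 3 + 2 * c\<^sup>2"
        "a1 * s ^ 6 = - c * (13 + 2 * c\<^sup>2)" "b * s ^ 6 = 3 + 12 * c\<^sup>2"
      using s(1) by (simp_all add: a1_def a2_def a3_def b_def)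
    have "(2 * a2 * s\<^sup>2 + 5 * c * a3) * s\<^sup>2 = 6 * s\<^sup>2"
      using f s(2) by algebra
    then have e2: "2 * a2 * s\<^sup>2 + 5 * c * a3 = 6"
      using s(1) by simp
    have "(a1 * s\<^sup>2 + 3 * c * a2 - 2 * a3) * s ^ 4 = 0"
      using f s(2) by algebra
    then have e1: "a1 * s\<^sup>2 + 3 * c * a2 - 2 * a3 = 0"
      using s(1) by simp
    have "(a1 * c - a2 + b) * s ^ 6 = 0"
      using f s(2) by algebra
    then have e0: "a1 * c - a2 + b = 0"
      using s(1) by simp
    show ?thesis using e0 e1 e2 f(1) by algebra
  qed
  have d: "(F has_real_derivative 6 * cosh u / (cosh u + c) ^ 4) (at u)" for u
  proof -
    have "(F has_real_derivative 6 * ((1 / (cosh u + c)) ^ 3 - c * (1 / (cosh u + c)) ^ 4)) (at u)"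
      unfolding F_def key[symmetric] s(2)
      by (rule DERIV_cong[OF DERIV_add[OF DERIV_add[OF DERIV_add[OF
            DERIV_cmult[OF DERIV_sinh_div_power[OF X[of u], where k = 0], of a1]
            DERIV_cmult[OF DERIV_sinh_div_power[OF X[of u], where k = 1], of a2]]
            DERIV_cmult[OF DERIV_sinh_div_power[OF X[of u], where k = 2], of a3]]
            DERIV_cmult[OF darct, of b]]])
         (simp add: eval_nat_numeral)
    also have "6 * ((1 / (cosh u + c)) ^ 3 - c * (1 / (cosh u + c)) ^ 4) = 6 * cosh u / (cosh u + c) ^ 4"
    proof -
      have "c * (1 / (cosh u + c)) = 1 - cosh u * (1 / (cosh u + c))"
        using X[of u] by (simp add: field_simps)
      then have "6 * ((1 / (cosh u + c)) ^ 3 - c * (1 / (cosh u + c)) ^ 4) =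
          6 * cosh u * (1 / (cosh u + c)) ^ 4"
        by algebra
      then show ?thesis by (simp add: power_divide)
    qed
    finally show ?thesis .
  qed
  have A: "(F \<longlongrightarrow> b * (2 / s * (pi / 2 - \<theta> / 2))) (at_right 0)"
  proof -
    have "isCont F 0" using d by (rule DERIV_isCont)
    moreover have "F 0 = b * (2 / s * (pi / 2 - \<theta> / 2))"
      using arctan_cot_half[OF \<theta>] by (simp add: F_def c_def s_def)
    ultimately show ?thesis
      by (simp add: isCont_def filterlim_at_split)
  qed
  have B: "(F \<longlongrightarrow> a1 * 1 + a2 * 0 + a3 * 0 + b * (2 / s * (pi / 2))) at_top"
    unfolding F_def
  proof (intro tendsto_intros)
    show "((\<lambda>u. sinh u / (cosh u + c) ^ Suc 0) \<longlongrightarrow> 1) at_top"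
      unfolding sinh_def cosh_def by simp real_asymp
    show "((\<lambda>u. sinh u / (cosh u + c) ^ Suc 1) \<longlongrightarrow> 0) at_top"
      unfolding sinh_def cosh_def by simp real_asymp
    show "((\<lambda>u. sinh u / (cosh u + c) ^ Suc 2) \<longlongrightarrow> 0) at_top"
      unfolding sinh_def cosh_def by (simp add: eval_nat_numeral) real_asymp
    show "((\<lambda>u. arctan ((exp u + c) / s)) \<longlongrightarrow> pi / 2) at_top"
      using s(1) by real_asymp
  qed
  have cont: "isCont (\<lambda>u. 6 * cosh u / (cosh u + c) ^ 4) u" for u
    using X[of u] by (intro continuous_intros) auto
  have nonneg: "0 \<le> 6 * cosh u / (cosh u + c) ^ 4" for u :: real
    using X[of u] by (simp add: less_imp_le)
  show "set_integrable lborel {0<..} (\<lambda>u. 6 * cosh u / (cosh u + cos \<theta>) ^ 4)"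
    using FTC_greaterThan_nonneg(1)[OF d cont nonneg A B] by (simp add: c_def)
  have "(LBINT u:{0<..}. 6 * cosh u / (cosh u + c) ^ 4) = a1 + b * \<theta> / s"
    using FTC_greaterThan_nonneg(2)[OF d cont nonneg A B] s(1) by (simp add: right_diff_distrib mult.commute[of \<theta>])
  also have "\<dots> = bessel_moment \<theta>"
    using s(1) unfolding a1_def b_def bessel_moment_def c_def[symmetric] s_def[symmetric]
    by (simp add: divide_simps) (simp add: eval_nat_numeral algebra_simps)
  finally show "(LBINT u:{0<..}. 6 * cosh u / (cosh u + cos \<theta>) ^ 4) = bessel_moment \<theta>"
    by (simp add: c_def)
qed

text \<open>Insert the integral that defines \<open>K\<^sub>1\<close> and integrate over \<open>t\<close> first: the inner integral is a Laplace
transform of \<open>t\<^sup>3\<close> at \<open>cosh u + cos \<theta>\<close>. All functions are nonnegative, so the finiteness of the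
iterated integral in this order already justifies the exchange.\<close>

lemma Bessel_K_1_moment:
  assumes \<theta>: "0 < \<theta>" "\<theta> < pi / 2"
  shows "(LBINT t:{0<..}. t ^ 3 * Bessel_K 1 t * exp (- t * cos \<theta>)) = bessel_moment \<theta>"
proof -
  define c where "c = cos \<theta>"
  have X: "cosh u + c > 0" for u :: real
    using \<theta> cosh_real_pos[of u] cos_gt_zero[of \<theta>] unfolding c_def by linarith
  define k where "k = (\<lambda>u t. indicator {0<..} u * indicator {0<..} t * (cosh u * (t ^ 3 * exp (- t * (cosh u + c)))) :: real)"
  have [measurable]: "(\<lambda>u::real. cosh u) \<in> borel_measurable borel"
    by (intro borel_measurable_continuous_onI continuous_intros)
  have k_meas: "case_prod k \<in> borel_measurable (lborel \<Otimes>\<^sub>M lborel)"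
    unfolding k_def by measurable
  have k_u: "(\<integral>t. k u t \<partial>lborel) = indicator {0<..} u * (6 * cosh u / (cosh u + c) ^ 4)" for u
  proof -
    have "(\<integral>t. k u t \<partial>lborel) = (\<integral>t. (indicator {0<..} u * cosh u) * (indicator {0<..} t * (t ^ 3 * exp (- t * (cosh u + c)))) \<partial>lborel)"
      by (simp add: k_def algebra_simps)
    also have "\<dots> = indicator {0<..} u * cosh u * (6 / (cosh u + c) ^ 4)"
      using Laplace_transform_cube(2)[OF X[of u]]
      by (simp only: integral_mult_right_zero set_lebesgue_integral_def real_scaleR_def)
    finally show ?thesis by simp
  qed
  have k_t: "(\<integral>u. k u t \<partial>lborel) = indicator {0<..} t * (t ^ 3 * Bessel_K 1 t * exp (- t * c))" for t
  proof -
    have "(\<integral>u. k u t \<partial>lborel) = (\<integral>u. (indicator {0<..} t * t ^ 3 * exp (- t * c)) * (indicator {0<..} u * (exp (- t * cosh u) * cosh (1 * u))) \<partial>lborel)"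
      by (intro Bochner_Integration.integral_cong) (simp_all add: k_def algebra_simps flip: exp_add)
    also have "\<dots> = indicator {0<..} t * t ^ 3 * exp (- t * c) * Bessel_K 1 t"
      by (simp only: integral_mult_right_zero Bessel_K_def set_lebesgue_integral_def real_scaleR_def)
    finally show ?thesis by simp
  qed
  have "integrable (lborel \<Otimes>\<^sub>M lborel) (case_prod k)"
  proof (rule lborel_pair.Fubini_integrable[OF k_meas])
    have [simp]: "\<bar>k u t\<bar> = k u t" for u t
      by (auto simp: k_def indicator_def)
    show "integrable lborel (\<lambda>u. \<integral>t. norm (case_prod k (u, t)) \<partial>lborel)"
      using cosh_div_power4_integral(1)[OF \<theta>]
      by (simp add: k_u set_integrable_def c_def)
    have "integrable lborel (k u)" for u
    proof -
      have "integrable lborel (\<lambda>t. (indicator {0<..} u * cosh u) * (indicator {0<..} t * (t ^ 3 * exp (- t * (cosh u + c)))))"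
        using Laplace_transform_cube(1)[OF X[of u]] 
        unfolding set_integrable_def real_scaleR_def by (rule integrable_mult_right)
      then show ?thesis by (simp add: k_def[abs_def] algebra_simps)
    qed
    then show "AE u in lborel. integrable lborel (\<lambda>t. case_prod k (u, t))"
      by simp
  qed
  then have "(\<integral>t. (\<integral>u. k u t \<partial>lborel) \<partial>lborel) = (\<integral>u. (\<integral>t. k u t \<partial>lborel) \<partial>lborel)"
    by (rule lborel_pair.Fubini_integral)
  then show ?thesis
    using cosh_div_power4_integral(2)[OF \<theta>]
    by (simp add: k_u k_t set_lebesgue_integral_def c_def)
qed

section \<open>The parametrisation by an angle\<close>

text \<open>The function \<open>h\<close> in terms of the angle \<open>\<theta>\<close> with \<open>y = 1 / cos \<theta>\<close>.\<close>

definition abscissa :: "real \<Rightarrow> real" where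
  "abscissa \<theta> = pi / (tan \<theta> - \<theta>)"

definition angle :: "real \<Rightarrow> real" where
  "angle x = arccos (1 / f x)"

lemma sin_cos_pos:
  assumes "0 < \<theta>" "\<theta> < pi / 2"
  shows "sin \<theta> > 0" "cos \<theta> > 0"
  using assms by (auto intro: sin_gt_zero cos_gt_zero)

lemma DERIV_tan_minus_id:
  assumes "cos \<theta> \<noteq> 0"
  shows "((\<lambda>\<theta>. tan \<theta> - \<theta>) has_real_derivative (tan \<theta>)\<^sup>2) (at \<theta>)"
proof -
  have "1 / (cos \<theta>)\<^sup>2 = 1 + (tan \<theta>)\<^sup>2"
    using assms tan_sec[of \<theta>] by (simp add: power_inverse divide_inverse)
  then show ?thesis
    using assms by (auto intro!: derivative_eq_intros simp: divide_inverse)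
qed

lemma tan_minus_id_strict_mono:
  assumes "0 \<le> \<theta>" "\<theta> < \<phi>" "\<phi> < pi / 2"
  shows "tan \<theta> - \<theta> < tan \<phi> - \<phi>"
proof (rule DERIV_pos_imp_increasing_open[OF assms(2)])
  fix t assume "\<theta> < t" "t < \<phi>"
  then have "sin t > 0" "cos t > 0"
    using assms sin_cos_pos[of t] by auto
  then show "\<exists>y. ((\<lambda>\<theta>. tan \<theta> - \<theta>) has_real_derivative y) (at t) \<and> y > 0"
    using DERIV_tan_minus_id[of t] by (intro exI[of _ "(tan t)\<^sup>2"]) (auto simp: tan_def)
next
  have "cos t \<noteq> 0" if "t \<in> {\<theta>..\<phi>}" for t
    using that assms cos_gt_zero_pi[of t] by auto
  then show "continuous_on {\<theta>..\<phi>} (\<lambda>\<theta>. tan \<theta> - \<theta>)"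
    by (intro continuous_intros) auto
qed

lemma tan_minus_id_pos:
  assumes "0 < \<theta>" "\<theta> < pi / 2"
  shows "0 < tan \<theta> - \<theta>"
  using tan_minus_id_strict_mono[of 0 \<theta>] assms by simp

lemma abscissa_pos:
  assumes "0 < \<theta>" "\<theta> < pi / 2"
  shows "0 < abscissa \<theta>"
  using tan_minus_id_pos[OF assms] by (simp add: abscissa_def)

lemma abscissa_strict_antimono:
  assumes "0 < \<theta>" "\<theta> < \<phi>" "\<phi> < pi / 2"
  shows "abscissa \<phi> < abscissa \<theta>"
  using tan_minus_id_strict_mono[of \<theta> \<phi>] tan_minus_id_pos[of \<theta>] assms
  by (simp add: abscissa_def divide_strict_left_mono)

lemma h_sec:
  assumes "0 < \<theta>" "\<theta> < pi / 2"
  shows "h (1 / cos \<theta>) = abscissa \<theta>"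
proof -
  have "(1 / cos \<theta>)\<^sup>2 - 1 = (tan \<theta>)\<^sup>2"
    using sin_cos_pos[OF assms] tan_sec[of \<theta>] by (simp add: power_inverse divide_inverse)
  moreover have "tan \<theta> > 0"
    using assms by (rule tan_gt_zero)
  ultimately show ?thesis
    using assms by (simp add: h_def abscissa_def arccos_cos)
qed

lemma sec_arccos:
  assumes "1 < y"
  shows "0 < arccos (1 / y)" "arccos (1 / y) < pi / 2" "1 / cos (arccos (1 / y)) = y"
proof -
  have *: "0 < 1 / y" "1 / y < 1"
    using assms by auto
  then have "cos (arccos (1 / y)) = 1 / y"
    by (intro cos_arccos) linarith+
  then show "1 / cos (arccos (1 / y)) = y"
    by simp
  show "0 < arccos (1 / y)"
    using arccos_less_arccos[of "1 / y" 1] * by simp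
  show "arccos (1 / y) < pi / 2"
    using arccos_less_arccos[of 0 "1 / y"] * by simp
qed

lemma f_abscissa:
  assumes "0 < \<theta>" "\<theta> < pi / 2"
  shows "f (abscissa \<theta>) = 1 / cos \<theta>"
proof -
  have inj: "inj_on h {1<..}"
  proof (rule inj_onI)
    fix y z :: real assume yz: "y \<in> {1<..}" "z \<in> {1<..}" and eq: "h y = h z"
    then have y: "1 < y" and z: "1 < z" by auto
    have "abscissa (arccos (1 / y)) = abscissa (arccos (1 / z))"
      using eq h_sec[OF sec_arccos(1,2)[OF y]] h_sec[OF sec_arccos(1,2)[OF z]]
      unfolding sec_arccos(3)[OF y] sec_arccos(3)[OF z] by simp
    then have "arccos (1 / y) = arccos (1 / z)"
      using abscissa_strict_antimono sec_arccos(1,2)[OF y] sec_arccos(1,2)[OF z]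
      by (metis less_irrefl linorder_neqE_linordered_idom)
    then show "y = z"
      using sec_arccos(3)[OF y] sec_arccos(3)[OF z] by metis
  qed
  have "cos \<theta> < 1"
    using assms cos_monotone_0_pi[of 0 \<theta>] by simp
  then have "1 / cos \<theta> \<in> {1<..}"
    using sin_cos_pos[OF assms] by simp
  then show ?thesis
    using the_inv_into_f_f[OF inj] h_sec[OF assms] unfolding f_def by metis
qed

lemma angle_abscissa:
  assumes "0 < \<theta>" "\<theta> < pi / 2"
  shows "angle (abscissa \<theta>) = \<theta>"
  using assms by (simp add: angle_def f_abscissa arccos_cos)

text \<open>The angle \<open>\<phi>\<close> below satisfies \<open>tan \<phi> = pi / x + 2\<close> and \<open>\<phi> < 2\<close>, so that \<open>tan \<phi> - \<phi>\<close> exceeds the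
value \<open>pi / x\<close> to be attained.\<close>

lemma abscissa_surj:
  assumes "0 < x"
  obtains \<theta> where "0 < \<theta>" "\<theta> < pi / 2" "abscissa \<theta> = x"
proof -
  define \<phi> where "\<phi> = arctan (pi / x + 2)"
  have \<phi>: "0 < \<phi>" "\<phi> < pi / 2"
    using assms arctan_ubound by (auto simp: \<phi>_def intro!: add_pos_pos)
  have "pi / x \<le> tan \<phi> - \<phi>"
    using \<phi>(2) pi_less_4 by (simp add: \<phi>_def tan_arctan)
  moreover have "continuous_on {0..\<phi>} (\<lambda>\<theta>. tan \<theta> - \<theta>)"
  proof -
    have "cos t \<noteq> 0" if "t \<in> {0..\<phi>}" for t
      using that \<phi> cos_gt_zero_pi[of t] by auto
    then show ?thesis
      by (intro continuous_intros) auto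
  qed
  ultimately obtain \<theta> where \<theta>: "0 \<le> \<theta>" "\<theta> \<le> \<phi>" "tan \<theta> - \<theta> = pi / x"
    using IVT'[of "\<lambda>\<theta>. tan \<theta> - \<theta>" 0 "pi / x" \<phi>] assms \<phi> by auto
  moreover have "\<theta> \<noteq> 0"
    using \<theta>(3) assms by auto
  ultimately show ?thesis
    using that[of \<theta>] \<phi> by (simp add: abscissa_def)
qed

lemma angle_bounds:
  assumes "0 < x"
  shows "0 < angle x" "angle x < pi / 2"
  using abscissa_surj[OF assms] angle_abscissa by metis+

lemma abscissa_angle:
  assumes "0 < x"
  shows "abscissa (angle x) = x"
  using abscissa_surj[OF assms] angle_abscissa by metis

lemma f_angle:
  assumes "0 < x"
  shows "f x = 1 / cos (angle x)" "sqrt ((f x)\<^sup>2 - 1) = tan (angle x)"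
proof -
  show f: "f x = 1 / cos (angle x)"
    using f_abscissa[OF angle_bounds[OF assms]] abscissa_angle[OF assms] by simp
  have "(1 / cos (angle x))\<^sup>2 - 1 = (tan (angle x))\<^sup>2"
    using sin_cos_pos[OF angle_bounds[OF assms]] tan_sec[of "angle x"] by (simp add: power_inverse divide_inverse)
  moreover have "tan (angle x) > 0"
    using angle_bounds[OF assms] by (rule tan_gt_zero)
  ultimately show "sqrt ((f x)\<^sup>2 - 1) = tan (angle x)"
    by (simp add: f)
qed

lemma DERIV_abscissa:
  assumes "0 < \<theta>" "\<theta> < pi / 2"
  shows "(abscissa has_real_derivative - (abscissa \<theta>)\<^sup>2 * (tan \<theta>)\<^sup>2 / pi) (at \<theta>)"
proof -
  have eq: "abscissa = (\<lambda>\<theta>. pi * inverse (tan \<theta> - \<theta>))"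
    by (simp add: abscissa_def[abs_def] divide_inverse)
  have "(abscissa has_real_derivative
      pi * - (inverse (tan \<theta> - \<theta>) * (tan \<theta>)\<^sup>2 * inverse (tan \<theta> - \<theta>))) (at \<theta>)"
    unfolding eq using sin_cos_pos[OF assms] tan_minus_id_pos[OF assms]
    by (intro DERIV_cmult DERIV_inverse' DERIV_tan_minus_id) auto
  also have "pi * - (inverse (tan \<theta> - \<theta>) * (tan \<theta>)\<^sup>2 * inverse (tan \<theta> - \<theta>)) =
      - (abscissa \<theta>)\<^sup>2 * (tan \<theta>)\<^sup>2 / pi"
    by (simp add: abscissa_def power2_eq_square inverse_eq_divide)
  finally show ?thesis .
qed

text \<open>The angle is the inverse of the continuous function \<open>abscissa\<close>; a compact neighbourhood of
\<open>angle x\<close> inside \<open>(0, pi/2)\<close> suffices for the continuity of its inverse at \<open>x\<close>.\<close>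

lemma isCont_angle:
  assumes "0 < x"
  shows "isCont angle x"
proof -
  let ?\<theta> = "angle x"
  have b: "0 < ?\<theta>" "?\<theta> < pi / 2"
    using angle_bounds[OF assms] by auto
  have "isCont angle (abscissa ?\<theta>)"
  proof (rule isCont_inverse_function2[where f = abscissa and x = "angle x"])
    show "?\<theta> / 2 < ?\<theta>" "?\<theta> < (?\<theta> + pi / 2) / 2"
      using b by auto
    fix z assume "?\<theta> / 2 \<le> z" "z \<le> (?\<theta> + pi / 2) / 2"
    then have z: "0 < z" "z < pi / 2"
      using b by auto
    show "angle (abscissa z) = z"
      using z by (rule angle_abscissa)
    show "isCont abscissa z"
      using DERIV_abscissa[OF z] by (rule DERIV_isCont)
  qed
  then show ?thesis
    by (simp add: abscissa_angle[OF assms])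
qed

lemma DERIV_angle:
  assumes "0 < x"
  shows "(angle has_real_derivative - pi / (x * tan (angle x))\<^sup>2) (at x)"
proof -
  have b: "0 < angle x" "angle x < pi / 2"
    using angle_bounds[OF assms] by auto
  have "tan (angle x) > 0"
    using b by (rule tan_gt_zero)
  then have "(angle has_real_derivative inverse (- x\<^sup>2 * (tan (angle x))\<^sup>2 / pi)) (at x)"
    using DERIV_abscissa[OF b] isCont_angle[OF assms] assms
    by (intro DERIV_inverse_function[where f = abscissa and a = 0 and b = "x + 1"])
       (auto simp: abscissa_angle)
  then show ?thesis
    by (simp add: divide_inverse power_mult_distrib mult_ac)
qed

text \<open>Since \<open>tan \<theta> \<ge> tan \<theta> - \<theta> = pi / x\<close> for \<open>\<theta> = angle x\<close>, the angle lies between \<open>arctan (pi / x)\<close> and \<open>pi / 2\<close>.\<close>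

lemma angle_tendsto_at_right_0: "(angle \<longlongrightarrow> pi / 2) (at_right 0)"
proof (rule tendsto_sandwich)
  show "\<forall>\<^sub>F x in at_right 0. arctan (pi / x) \<le> angle x"
    using eventually_at_right_less[of 0]
  proof eventually_elim
    case (elim x)
    have b: "0 < angle x" "angle x < pi / 2"
      using angle_bounds[OF elim] by auto
    have "pi / x = tan (angle x) - angle x"
      using abscissa_angle[OF elim] tan_minus_id_pos[OF b] elim by (auto simp: abscissa_def field_simps)
    then have "pi / x \<le> tan (angle x)"
      using b by linarith
    then have "arctan (pi / x) \<le> arctan (tan (angle x))"
      by (rule arctan_monotone')
    then show ?case
      using b by (simp add: arctan_tan)
  qed
  show "\<forall>\<^sub>F x in at_right 0. angle x \<le> pi / 2"
    using eventually_at_right_less[of 0] by eventually_elim (use angle_bounds in \<open>simp add: less_imp_le\<close>)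
  show "((\<lambda>x. arctan (pi / x)) \<longlongrightarrow> pi / 2) (at_right 0)"
    by real_asymp
qed simp

lemma angle_tendsto_at_top: "(angle \<longlongrightarrow> 0) at_top"
proof (rule order_tendstoI)
  fix a :: real assume "a < 0"
  show "\<forall>\<^sub>F x in at_top. a < angle x"
    using eventually_gt_at_top[of 0]
    by eventually_elim (use angle_bounds(1) \<open>a < 0\<close> in \<open>auto intro: less_trans\<close>)
next
  fix a :: real assume "0 < a"
  define e where "e = min a 1"
  have e: "0 < e" "e < pi / 2" "e \<le> a"
    using \<open>0 < a\<close> pi_gt3 by (auto simp: e_def)
  show "\<forall>\<^sub>F x in at_top. angle x < a"
    using eventually_gt_at_top[of "abscissa e"]
  proof eventually_elim
    case (elim x)
    then have x: "0 < x"
      using abscissa_pos[OF e(1,2)] by simp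
    show ?case
    proof (rule ccontr)
      assume "\<not> angle x < a"
      then have "e \<le> angle x"
        using e(3) by simp
      then have "abscissa (angle x) \<le> abscissa e"
        using abscissa_strict_antimono[OF e(1), of "angle x"] angle_bounds[OF x]
        by (cases "e = angle x") auto
      then show False
        using elim abscissa_angle[OF x] by simp
    qed
  qed
qed

section \<open>The second derivative of $g$\<close>

lemma DERIV_arccos_inverse:
  fixes t :: real
  assumes "1 < t"
  defines "\<theta> \<equiv> arccos (1 / t)"
  shows "((\<lambda>t. arccos (1 / t)) has_real_derivative (cos \<theta>)\<^sup>2 / sin \<theta>) (at t)"
proof -
  have *: "- 1 < 1 / t" "1 / t < 1"
    using assms by (auto intro: less_trans[of _ 0])
  have "((\<lambda>t. arccos (1 / t)) has_real_derivative inverse (- sqrt (1 - (1 / t)\<^sup>2)) * (- (1 / t\<^sup>2))) (at t)"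
    by (rule DERIV_chain2[OF DERIV_arccos])
       (use * assms in \<open>auto intro!: derivative_eq_intros simp: power2_eq_square\<close>)
  also have "inverse (- sqrt (1 - (1 / t)\<^sup>2)) * (- (1 / t\<^sup>2)) = (cos \<theta>)\<^sup>2 / sin \<theta>"
    using * unfolding \<theta>_def by (simp add: sin_arccos cos_arccos power_divide inverse_eq_divide)
  finally show ?thesis .
qed

text \<open>In the angle \<open>\<theta> = arccos (1 / t)\<close> the function \<open>g\<close> is \<open>\<theta> / sin \<theta>\<close>, and \<open>d/dt\<close> acts as
\<open>(cos\<^sup>2 \<theta> / sin \<theta>) d/d\<theta>\<close>. Applying this operator twice gives the formula.\<close>

lemma deriv_deriv_g:
  assumes "0 < \<theta>" "\<theta> < pi / 2"
  shows "deriv (deriv g) (1 / cos \<theta>) =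
    - (cos \<theta> ^ 3) * (3 * sin \<theta> - sin \<theta> ^ 3 - 3 * \<theta> * cos \<theta>) / sin \<theta> ^ 5"
proof -
  let ?A = "\<lambda>t. arccos (1 / t)"
  define G1 where "G1 = (\<lambda>\<theta>::real. (cos \<theta>)\<^sup>2 * (sin \<theta> - \<theta> * cos \<theta>) / sin \<theta> ^ 3)"
  define G2 where "G2 = (\<lambda>\<theta>::real. - (cos \<theta> ^ 3) * (3 * sin \<theta> - sin \<theta> ^ 3 - 3 * \<theta> * cos \<theta>) / sin \<theta> ^ 5)"
  have D0: "((\<lambda>\<theta>. \<theta> / sin \<theta>) has_real_derivative (sin \<theta> - \<theta> * cos \<theta>) / (sin \<theta>)\<^sup>2) (at \<theta>)"
    if "sin \<theta> > 0" for \<theta> :: real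
    using that by (auto intro!: derivative_eq_intros simp: power2_eq_square)
  have D1: "(G1 has_real_derivative
       - cos \<theta> * (3 * sin \<theta> - sin \<theta> ^ 3 - 3 * \<theta> * cos \<theta>) / sin \<theta> ^ 4) (at \<theta>)"
    if "sin \<theta> > 0" for \<theta> :: real
  proof (rule DERIV_cong)
    show "(G1 has_real_derivative
       ((- 2 * cos \<theta> * sin \<theta> * (sin \<theta> - \<theta> * cos \<theta>) + (cos \<theta>)\<^sup>2 * (\<theta> * sin \<theta>)) * sin \<theta> ^ 3
         - (cos \<theta>)\<^sup>2 * (sin \<theta> - \<theta> * cos \<theta>) * (3 * (sin \<theta>)\<^sup>2 * cos \<theta>)) / (sin \<theta> ^ 3 * sin \<theta> ^ 3)) (at \<theta>)"
      unfolding G1_def using that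
      by (auto intro!: derivative_eq_intros)
    have "(- 2 * cos \<theta> * sin \<theta> * (sin \<theta> - \<theta> * cos \<theta>) + (cos \<theta>)\<^sup>2 * (\<theta> * sin \<theta>)) * sin \<theta> ^ 3
         - (cos \<theta>)\<^sup>2 * (sin \<theta> - \<theta> * cos \<theta>) * (3 * (sin \<theta>)\<^sup>2 * cos \<theta>)
       = - cos \<theta> * (3 * sin \<theta> - sin \<theta> ^ 3 - 3 * \<theta> * cos \<theta>) * (sin \<theta>)\<^sup>2"
      using sin_cos_squared_add[of \<theta>] by algebra
    then show "((- 2 * cos \<theta> * sin \<theta> * (sin \<theta> - \<theta> * cos \<theta>) + (cos \<theta>)\<^sup>2 * (\<theta> * sin \<theta>)) * sin \<theta> ^ 3
         - (cos \<theta>)\<^sup>2 * (sin \<theta> - \<theta> * cos \<theta>) * (3 * (sin \<theta>)\<^sup>2 * cos \<theta>)) / (sin \<theta> ^ 3 * sin \<theta> ^ 3)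
       = - cos \<theta> * (3 * sin \<theta> - sin \<theta> ^ 3 - 3 * \<theta> * cos \<theta>) / sin \<theta> ^ 4"
      using that by (simp add: divide_simps)
  qed
  have sinA: "sin (?A t) > 0" if "t > 1" for t
    using sin_cos_pos sec_arccos[OF that] by blast
  have g1: "(g has_real_derivative G1 (?A t)) (at t)" if t: "t > 1" for t
  proof (rule has_field_derivative_transform_within_open)
    have "((\<lambda>t. ?A t / sin (?A t)) has_real_derivative
        (sin (?A t) - ?A t * cos (?A t)) / (sin (?A t))\<^sup>2 * ((cos (?A t))\<^sup>2 / sin (?A t))) (at t)"
      by (rule DERIV_chain2[OF D0[OF sinA[OF t]] DERIV_arccos_inverse[OF t]])
    then show "((\<lambda>t. ?A t / sin (?A t)) has_real_derivative G1 (?A t)) (at t)"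
      by (simp add: G1_def power2_eq_square power3_eq_cube mult_ac)
    show "?A u / sin (?A u) = g u" if "u \<in> {1<..}" for u
    proof -
      have "- 1 \<le> 1 / u" "1 / u \<le> 1"
        using that by (auto intro: order_trans[of _ 0])
      then show ?thesis
        by (simp add: g_def sin_arccos power_divide)
    qed
  qed (use t in auto)
  have g2: "(deriv g has_real_derivative G2 (?A t)) (at t)" if t: "t > 1" for t
  proof (rule has_field_derivative_transform_within_open)
    have "((\<lambda>t. G1 (?A t)) has_real_derivative
        - cos (?A t) * (3 * sin (?A t) - sin (?A t) ^ 3 - 3 * ?A t * cos (?A t)) / sin (?A t) ^ 4
          * ((cos (?A t))\<^sup>2 / sin (?A t))) (at t)"
      by (rule DERIV_chain2[OF D1[OF sinA[OF t]] DERIV_arccos_inverse[OF t]])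
    moreover have "- cos (?A t) * (3 * sin (?A t) - sin (?A t) ^ 3 - 3 * ?A t * cos (?A t)) / sin (?A t) ^ 4
          * ((cos (?A t))\<^sup>2 / sin (?A t)) = G2 (?A t)"
      unfolding G2_def by (simp add: eval_nat_numeral mult_ac)
    ultimately show "((\<lambda>t. G1 (?A t)) has_real_derivative G2 (?A t)) (at t)"
      by simp
    show "G1 (?A u) = deriv g u" if "u \<in> {1<..}" for u
      using that g1[of u] by (simp add: DERIV_imp_deriv)
  qed (use t in auto)
  have "cos \<theta> < 1"
    using assms cos_monotone_0_pi[of 0 \<theta>] by simp
  then have "1 / cos \<theta> > 1"
    using sin_cos_pos[OF assms] by simp
  then have "deriv (deriv g) (1 / cos \<theta>) = G2 (?A (1 / cos \<theta>))"
    by (intro DERIV_imp_deriv g2)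
  then show ?thesis
    using assms by (simp add: G2_def arccos_cos)
qed

section \<open>The density in the angle, and its primitive\<close>

text \<open>The density of the measure \<open>\<Theta>\<^sub>0(x) dx\<close> after the change of variables \<open>x = abscissa \<theta>\<close>; the first
summand comes from \<open>g''\<close>, the second from the Bessel integral.\<close>

definition angular_density :: "real \<Rightarrow> real" where
  "angular_density \<theta> =
     cos \<theta> * (3 * sin \<theta> - sin \<theta> ^ 3 - 3 * \<theta> * cos \<theta>) / (8 * sin \<theta> ^ 4)
     + sin \<theta> ^ 3 * bessel_moment \<theta> / (6 * pi\<^sup>2)"

text \<open>A primitive of the negative of the density. The first summand is an elementary integral. The
numerator of the second is found by regarding the moment as a function of \<open>c = cos \<theta>\<close>: if \<open>J\<^sub>k\<close> is
the \<open>k\<close>-th derivative of \<open>\<integral>\<^sub>0\<^sup>\<infinity> du / (cosh u + c) = \<theta> / sin \<theta>\<close> with respect to \<open>c\<close>, then the moment is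
\<open>3 J\<^sub>2 + c J\<^sub>3\<close>, and \<open>(1 - c\<^sup>2) (3 J\<^sub>2 + c J\<^sub>3)\<close> is the derivative of \<open>c (1 - c\<^sup>2) J\<^sub>2 + 2 J\<^sub>1\<close>.\<close>

definition primitive :: "real \<Rightarrow> real" where
  "primitive \<theta> = - (\<theta> * cos \<theta> ^ 3 / sin \<theta> ^ 3 - 1 / (sin \<theta>)\<^sup>2) / 8
     + (\<theta> * cos \<theta> * (3 + 2 * (cos \<theta>)\<^sup>2) - 3 * (cos \<theta>)\<^sup>2 * sin \<theta> - 2 * sin \<theta>)
        / (6 * pi\<^sup>2 * sin \<theta> ^ 3)"

text \<open>The factor \<open>pi / (x tan \<theta>)\<^sup>2\<close> is \<open>- d\<theta>/dx\<close>.\<close>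

lemma Theta0_eq:
  assumes "0 < x"
  shows "Theta0 x = angular_density (angle x) * (pi / (x * tan (angle x))\<^sup>2)"
proof -
  define \<theta> c s where "\<theta> = angle x" and "c = cos \<theta>" and "s = sin \<theta>"
  have b: "0 < \<theta>" "\<theta> < pi / 2"
    using angle_bounds[OF assms] by (auto simp: \<theta>_def)
  have sc: "s > 0" "c > 0"
    using sin_cos_pos[OF b] by (auto simp: s_def c_def)
  have fx: "f x = 1 / c" "sqrt ((f x)\<^sup>2 - 1) = s / c"
    using f_angle[OF assms] by (simp_all add: \<theta>_def c_def s_def tan_def)
  have "(LBINT t:{0<..}. t ^ 3 * Bessel_K 1 t * exp (- t / f x)) = bessel_moment \<theta>"
    using Bessel_K_1_moment[OF b] by (simp add: fx c_def)
  then have D: "D x = - (c\<^sup>2 / (12 * x\<^sup>2)) * bessel_moment \<theta>"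
    by (simp add: D_def fx power_divide)
  have g: "deriv (deriv g) (f x) = - (c ^ 3) * (3 * s - s ^ 3 - 3 * \<theta> * c) / s ^ 5"
    using deriv_deriv_g[OF b] by (simp add: fx c_def s_def)
  have t: "tan \<theta> = s / c"
    by (simp add: tan_def c_def s_def)
  have "Theta0 x = (pi / (8 * x\<^sup>2)) * (c ^ 3 * (3 * s - s ^ 3 - 3 * \<theta> * c) / s ^ 5) * (1 / s)
      + c\<^sup>2 / (12 * x\<^sup>2) * bessel_moment \<theta> * (2 / pi) * s"
    unfolding Theta0_def g D fx(2) using sc by (simp add: fx(1))
  also have "\<dots> = angular_density \<theta> * (pi / (x * tan \<theta>)\<^sup>2)"
  proof -
    have "(pi / (8 * x\<^sup>2)) * (c ^ 3 * Q / s ^ 5) * (1 / s) = c * Q / (8 * s ^ 4) * (pi / (x * (s / c))\<^sup>2)" for Q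
      using sc by (simp add: power_mult_distrib power_divide eval_nat_numeral mult_ac)
    moreover have "c\<^sup>2 / (12 * x\<^sup>2) * M * (2 / pi) * s = s ^ 3 * M / (6 * pi\<^sup>2) * (pi / (x * (s / c))\<^sup>2)" for M
      using sc by (simp add: power_mult_distrib power_divide eval_nat_numeral mult_ac)
    ultimately show ?thesis
      unfolding angular_density_def t c_def[symmetric] s_def[symmetric] distrib_right by simp
  qed
  finally show ?thesis
    by (simp add: \<theta>_def)
qed

lemma DERIV_primitive:
  assumes "sin \<theta> > 0"
  shows "(primitive has_real_derivative - angular_density \<theta>) (at \<theta>)"
proof -
  define c s where "c = cos \<theta>" and "s = sin \<theta>"
  have s: "s > 0" and cs: "c\<^sup>2 = 1 - s\<^sup>2"
    using assms by (simp_all add: s_def c_def cos_squared_eq)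
  have 1: "((\<lambda>\<theta>. \<theta> * cos \<theta> ^ 3 / sin \<theta> ^ 3 - 1 / (sin \<theta>)\<^sup>2) has_real_derivative
      c * (3 * s - s ^ 3 - 3 * \<theta> * c) / s ^ 4) (at \<theta>)"
  proof (rule DERIV_cong)
    let ?N = "(c ^ 3 - 3 * (s * c\<^sup>2) * \<theta>) * s ^ 3 - \<theta> * c ^ 3 * (3 * (c * s\<^sup>2))"
    show "((\<lambda>\<theta>. \<theta> * cos \<theta> ^ 3 / sin \<theta> ^ 3 - 1 / (sin \<theta>)\<^sup>2) has_real_derivative
      ?N / s ^ 6 + 2 * (c * s) / s ^ 4) (at \<theta>)"
      unfolding c_def s_def using assms by (auto intro!: derivative_eq_intros)
    have "?N / s ^ 6 + 2 * (c * s) / s ^ 4 = (?N + 2 * (c * s) * s\<^sup>2) / s ^ 6"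
      using s by (simp add: add_divide_distrib) (simp add: eval_nat_numeral)
    also have "?N + 2 * (c * s) * s\<^sup>2 = c * (3 * s - s ^ 3 - 3 * \<theta> * c) * s\<^sup>2"
      using cs by algebra
    also have "\<dots> / s ^ 6 = c * (3 * s - s ^ 3 - 3 * \<theta> * c) / s ^ 4"
      using s by (simp add: divide_simps)
    finally show "?N / s ^ 6 + 2 * (c * s) / s ^ 4 = c * (3 * s - s ^ 3 - 3 * \<theta> * c) / s ^ 4" .
  qed
  have 2: "((\<lambda>\<theta>. (\<theta> * cos \<theta> * (3 + 2 * (cos \<theta>)\<^sup>2) - 3 * (cos \<theta>)\<^sup>2 * sin \<theta> - 2 * sin \<theta>)
        / (6 * pi\<^sup>2 * sin \<theta> ^ 3)) has_real_derivative
      - (3 * \<theta> * (1 + 4 * c\<^sup>2) - c * s * (13 + 2 * c\<^sup>2)) / (6 * pi\<^sup>2 * s ^ 4)) (at \<theta>)"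
  proof (rule DERIV_cong)
    let ?N = "\<theta> * c * (3 + 2 * c\<^sup>2) - 3 * c\<^sup>2 * s - 2 * s"
    let ?N' = "(c - \<theta> * s) * (3 + 2 * c\<^sup>2) - 4 * \<theta> * c\<^sup>2 * s + 6 * c * s\<^sup>2 - 3 * c ^ 3 - 2 * c"
    show "((\<lambda>\<theta>. (\<theta> * cos \<theta> * (3 + 2 * (cos \<theta>)\<^sup>2) - 3 * (cos \<theta>)\<^sup>2 * sin \<theta> - 2 * sin \<theta>)
        / (6 * pi\<^sup>2 * sin \<theta> ^ 3)) has_real_derivative
      (?N' * (6 * pi\<^sup>2 * s ^ 3) - ?N * (18 * pi\<^sup>2 * s\<^sup>2 * c)) / ((6 * pi\<^sup>2 * s ^ 3) * (6 * pi\<^sup>2 * s ^ 3))) (at \<theta>)"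
      unfolding c_def s_def using assms
      by (auto intro!: derivative_eq_intros simp: power2_eq_square power3_eq_cube algebra_simps)
    have "(?N' * (6 * pi\<^sup>2 * s ^ 3) - ?N * (18 * pi\<^sup>2 * s\<^sup>2 * c))
        = - (3 * \<theta> * (1 + 4 * c\<^sup>2) - c * s * (13 + 2 * c\<^sup>2)) * (6 * pi\<^sup>2 * s\<^sup>2)"
      using cs by algebra
    then show "(?N' * (6 * pi\<^sup>2 * s ^ 3) - ?N * (18 * pi\<^sup>2 * s\<^sup>2 * c)) / ((6 * pi\<^sup>2 * s ^ 3) * (6 * pi\<^sup>2 * s ^ 3))
        = - (3 * \<theta> * (1 + 4 * c\<^sup>2) - c * s * (13 + 2 * c\<^sup>2)) / (6 * pi\<^sup>2 * s ^ 4)"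
      using s by (simp only:) (simp add: divide_simps)
  qed
  have "(primitive has_real_derivative - (c * (3 * s - s ^ 3 - 3 * \<theta> * c) / s ^ 4) / 8
      + - (3 * \<theta> * (1 + 4 * c\<^sup>2) - c * s * (13 + 2 * c\<^sup>2)) / (6 * pi\<^sup>2 * s ^ 4)) (at \<theta>)"
    unfolding primitive_def[abs_def] by (intro DERIV_add DERIV_cdivide DERIV_minus 1 2)
  also have "- (c * (3 * s - s ^ 3 - 3 * \<theta> * c) / s ^ 4) / 8
      + - (3 * \<theta> * (1 + 4 * c\<^sup>2) - c * s * (13 + 2 * c\<^sup>2)) / (6 * pi\<^sup>2 * s ^ 4) = - angular_density \<theta>"
  proof -
    have "- Q / (6 * pi\<^sup>2 * s ^ 4) = - (s ^ 3 * (Q / s ^ 7) / (6 * pi\<^sup>2))" for Q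
      using s by (simp add: eval_nat_numeral)
    then show ?thesis
      unfolding angular_density_def bessel_moment_def c_def[symmetric] s_def[symmetric] minus_add_distrib
      by (simp only:) (simp add: mult.commute)
  qed
  finally show ?thesis .
qed

text \<open>The difference of the two sides vanishes at \<open>0\<close> and has derivative \<open>3 sin \<theta> (\<theta> - sin \<theta> cos \<theta>)\<close>, which
is positive.\<close>

lemma three_sin_minus_cube_gt:
  assumes "0 < \<theta>" "\<theta> < pi / 2"
  shows "3 * \<theta> * cos \<theta> < 3 * sin \<theta> - sin \<theta> ^ 3"
proof -
  let ?p = "\<lambda>t::real. 3 * sin t - sin t ^ 3 - 3 * t * cos t"
  have "?p 0 < ?p \<theta>"
  proof (rule DERIV_pos_imp_increasing_open[OF assms(1)])
    fix t assume "0 < t" "t < \<theta>"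
    then have t: "0 < t" "t < pi / 2" "sin t > 0"
      using assms sin_cos_pos[of t] by auto
    have "cos t < 1"
      using t cos_monotone_0_pi[of 0 t] by simp
    then have "sin t * cos t < sin t * 1"
      using t by (intro mult_strict_left_mono) auto
    also have "\<dots> \<le> t"
      using t sin_x_le_x[of t] by simp
    finally have "3 * sin t * (t - sin t * cos t) > 0"
      using t by simp
    moreover have "(?p has_real_derivative 3 * sin t * (t - sin t * cos t)) (at t)"
      by (auto intro!: derivative_eq_intros simp: algebra_simps power2_eq_square)
    ultimately show "\<exists>y. (?p has_real_derivative y) (at t) \<and> y > 0"
      by blast
  qed (intro continuous_intros)
  then show ?thesis
    by simp
qed

text \<open>The sign is not visible in the closed form, but it is in the integral.\<close>

lemma bessel_moment_nonneg:
  assumes "0 < \<theta>" "\<theta> < pi / 2"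
  shows "0 \<le> bessel_moment \<theta>"
proof -
  have "0 \<le> (LBINT u:{0<..}. 6 * cosh u / (cosh u + cos \<theta>) ^ 4)"
    unfolding set_lebesgue_integral_def by (intro Bochner_Integration.integral_nonneg) auto
  then show ?thesis
    using cosh_div_power4_integral(2)[OF assms] by simp
qed

lemma angular_density_pos:
  assumes "0 < \<theta>" "\<theta> < pi / 2"
  shows "0 < angular_density \<theta>"
  unfolding angular_density_def
  using sin_cos_pos[OF assms] three_sin_minus_cube_gt[OF assms] bessel_moment_nonneg[OF assms]
  by (intro add_pos_nonneg divide_pos_pos mult_pos_pos) auto

lemma Theta0_pos:
  assumes "0 < x"
  shows "0 < Theta0 x"
proof -
  have "tan (angle x) > 0"
    using angle_bounds[OF assms] by (rule tan_gt_zero)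
  then show ?thesis
    using assms angular_density_pos[OF angle_bounds[OF assms]] by (simp add: Theta0_eq)
qed

lemma continuous_on_angle: "continuous_on {0<..} angle"
  by (simp add: continuous_on_eq_continuous_at isCont_angle)

lemma isCont_Theta0:
  assumes "0 < x"
  shows "isCont Theta0 x"
proof -
  have "sin (angle x) > 0" "cos (angle x) > 0" "tan (angle x) > 0" if "x > 0" for x
    using sin_cos_pos[OF angle_bounds[OF that]] tan_gt_zero[OF angle_bounds[OF that]] by auto
  then have "continuous_on {0<..} (\<lambda>x. angular_density (angle x) * (pi / (x * tan (angle x))\<^sup>2))"
    unfolding angular_density_def bessel_moment_def
    by (intro continuous_intros continuous_on_angle) (auto simp: less_le)
  then have "continuous_on {0<..} Theta0"
    by (rule continuous_on_cong[THEN iffD1, rotated -1]) (auto simp: Theta0_eq)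
  then show ?thesis
    using assms by (simp add: continuous_on_eq_continuous_at)
qed

lemma DERIV_primitive_angle:
  assumes "0 < x"
  shows "((\<lambda>x. primitive (angle x)) has_real_derivative Theta0 x) (at x)"
proof -
  have "sin (angle x) > 0"
    using sin_cos_pos[OF angle_bounds[OF assms]] by simp
  from DERIV_chain2[OF DERIV_primitive[OF this] DERIV_angle[OF assms]]
  show ?thesis
    by (simp add: Theta0_eq[OF assms])
qed

section \<open>The integral of $\Theta_0$\<close>

lemma primitive_angle_tendsto_at_right_0:
  "((\<lambda>x. primitive (angle x)) \<longlongrightarrow> primitive (pi / 2)) (at_right 0)"
  using DERIV_isCont[OF DERIV_primitive, of "pi / 2"] angle_tendsto_at_right_0
  by (intro isCont_tendsto_compose[of _ primitive]) auto

lemma angle_at_right_0: "filterlim angle (at_right 0) at_top"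
proof -
  have "\<forall>\<^sub>F x in at_top. angle x \<in> {0<..} \<and> angle x \<noteq> 0"
    using eventually_gt_at_top[of 0] 
  proof eventually_elim
    case (elim x)
    then show ?case
      using angle_bounds(1)[of x] by simp
  qed
  then show ?thesis
    using angle_tendsto_at_top by (simp add: filterlim_at)
qed

lemma primitive_angle_tendsto_at_top:
  "((\<lambda>x. primitive (angle x)) \<longlongrightarrow> 1 / 6 - 1 / (9 * pi\<^sup>2)) at_top"
proof (rule filterlim_compose[OF _ angle_at_right_0])
  have 1: "((\<lambda>\<theta>::real. \<theta> * cos \<theta> ^ 3 / sin \<theta> ^ 3 - 1 / (sin \<theta>)\<^sup>2) \<longlongrightarrow> - (4 / 3)) (at_right 0)"
    by real_asymp
  have 2: "((\<lambda>\<theta>::real. (\<theta> * cos \<theta> * (3 + 2 * (cos \<theta>)\<^sup>2) - 3 * (cos \<theta>)\<^sup>2 * sin \<theta> - 2 * sin \<theta>)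
      / sin \<theta> ^ 3) \<longlongrightarrow> - (2 / 3)) (at_right 0)"
    by real_asymp
  have "((\<lambda>\<theta>. - (\<theta> * cos \<theta> ^ 3 / sin \<theta> ^ 3 - 1 / (sin \<theta>)\<^sup>2) / 8
     + (\<theta> * cos \<theta> * (3 + 2 * (cos \<theta>)\<^sup>2) - 3 * (cos \<theta>)\<^sup>2 * sin \<theta> - 2 * sin \<theta>) / sin \<theta> ^ 3
        / (6 * pi\<^sup>2)) \<longlongrightarrow> - (- (4 / 3)) / 8 + - (2 / 3) / (6 * pi\<^sup>2)) (at_right 0)"
    by (intro tendsto_intros 1 2) auto
  then show "(primitive \<longlongrightarrow> 1 / 6 - 1 / (9 * pi\<^sup>2)) (at_right 0)"
    by (simp add: primitive_def[abs_def] mult_ac)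
qed

lemma Theta0_integral:
  assumes "0 < x"
  shows "(LBINT t:{0<..<x}. Theta0 t) = primitive (angle x) - primitive (pi / 2)"
proof -
  have "(LBINT t=ereal 0..ereal x. Theta0 t) = primitive (angle x) - primitive (pi / 2)"
  proof (rule interval_integral_FTC_nonneg(2))
    have "isCont (\<lambda>x. primitive (angle x)) x"
      using DERIV_primitive_angle[OF assms] by (rule DERIV_isCont)
    then show "(((\<lambda>x. primitive (angle x)) \<circ> real_of_ereal) \<longlongrightarrow> primitive (angle x)) (at_left (ereal x))"
      by (simp add: ereal_tendsto_simps isCont_def filterlim_at_split)
    show "(((\<lambda>x. primitive (angle x)) \<circ> real_of_ereal) \<longlongrightarrow> primitive (pi / 2)) (at_right (ereal 0))"
      using primitive_angle_tendsto_at_right_0 by (simp add: ereal_tendsto_simps del: zero_ereal_def)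
    show "AE t in lborel. ereal 0 < ereal t \<longrightarrow> ereal t < ereal x \<longrightarrow> 0 \<le> Theta0 t"
      by (simp add: Theta0_pos less_imp_le)
  qed (use assms DERIV_primitive_angle isCont_Theta0 in auto)
  then show ?thesis
    using assms by (simp add: interval_lebesgue_integral_def)
qed

section \<open>The zero of $\zeta$\<close>

theorem lemma4p2:
  "continuous_on {0<..} zeta \<and>
   (zeta \<longlongrightarrow> 1 / (8 * pi)) (at_right 0) \<and>
   filterlim zeta at_bot at_top \<and>
   (\<exists>!x0. x0 \<in> {0<..} \<and> (\<forall>x\<in>{0<..}. zeta x = 0 \<longleftrightarrow> x = x0))"
proof -
  define M where "M = (\<lambda>x. primitive (angle x) - primitive (pi / 2))"
  define \<kappa> where "\<kappa> = 1 / (2 * pi\<^sup>2)"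
  have sin_pos: "sin (angle x) > 0" if "0 < x" for x
    using sin_cos_pos[OF angle_bounds[OF that]] by simp
  have zeta: "zeta x = (\<kappa> - M x) * (pi / (4 * sin (angle x)))" if "0 < x" for x
  proof -
    have "cos (angle x) > 0"
      using sin_cos_pos[OF angle_bounds[OF that]] by simp
    then have "f x / sqrt ((f x)\<^sup>2 - 1) = 1 / sin (angle x)"
      unfolding f_angle(2)[OF that] unfolding f_angle(1)[OF that] tan_def by simp
    then show ?thesis
      unfolding zeta_def Theta0_integral[OF that] M_def \<kappa>_def by simp
  qed

  have M_cont: "continuous_on {0<..} M"
    unfolding M_def using DERIV_isCont[OF DERIV_primitive_angle]
    by (intro continuous_intros) (simp add: continuous_on_eq_continuous_at)
  have M_less: "M a < M b" if "0 < a" "a < b" for a b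
  proof (rule DERIV_pos_imp_increasing[OF that(2)])
    fix x assume "a \<le> x"
    then have "0 < x" using that by simp
    then have "(M has_real_derivative Theta0 x - 0) (at x)"
      unfolding M_def by (intro DERIV_diff DERIV_primitive_angle DERIV_const)
    then show "\<exists>y. (M has_real_derivative y) (at x) \<and> 0 < y"
      using Theta0_pos[OF \<open>0 < x\<close>] by auto
  qed
  have M_0: "(M \<longlongrightarrow> 0) (at_right 0)"
    unfolding M_def by (rule tendsto_eq_intros primitive_angle_tendsto_at_right_0 refl)+ simp
  \<comment> \<open>the total integral of \<open>\<Theta>\<^sub>0\<close>, which equals \<open>1/24 + 2 / (9 pi\<^sup>2)\<close>\<close>
  define m where "m = 1 / 6 - 1 / (9 * pi\<^sup>2) - primitive (pi / 2)"
  have M_top: "(M \<longlongrightarrow> m) at_top"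
    unfolding M_def m_def by (intro tendsto_intros primitive_angle_tendsto_at_top)
  \<comment> \<open>this inequality decides the limit at infinity; it says that \<open>pi\<^sup>2 > 20/3\<close>\<close>
  have m: "\<kappa> < m"
  proof -
    have prim: "primitive (pi / 2) = 1 / 8 - 1 / (3 * pi\<^sup>2)"
      by (simp add: primitive_def)
    have "m - \<kappa> = 1 / 24 - 5 / (18 * pi\<^sup>2)"
      unfolding m_def \<kappa>_def prim by (simp add: field_simps)
    moreover have "9 < pi\<^sup>2"
      using power_strict_mono[of 3 pi 2] pi_gt3 by simp
    then have "5 / (18 * pi\<^sup>2) < 1 / 24"
      by (simp add: field_simps)
    ultimately show ?thesis by linarith
  qed

  have "continuous_on {0<..} (\<lambda>x. (\<kappa> - M x) * (pi / (4 * sin (angle x))))"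
    using sin_pos by (intro continuous_intros continuous_on_angle M_cont) (auto simp: less_le)
  then have 1: "continuous_on {0<..} zeta"
    by (rule continuous_on_cong[THEN iffD1, rotated -1]) (auto simp: zeta)

  have "((\<lambda>x. (\<kappa> - M x) * (pi / (4 * sin (angle x)))) \<longlongrightarrow> (\<kappa> - 0) * (pi / (4 * sin (pi / 2)))) (at_right 0)"
    by (intro tendsto_intros M_0 angle_tendsto_at_right_0) auto
  then have "((\<lambda>x. (\<kappa> - M x) * (pi / (4 * sin (angle x)))) \<longlongrightarrow> 1 / (8 * pi)) (at_right 0)"
    by (simp add: \<kappa>_def power2_eq_square)
  then have 2: "(zeta \<longlongrightarrow> 1 / (8 * pi)) (at_right 0)"
    by (rule Lim_transform_eventually)
       (use eventually_at_right_less[of 0] in eventually_elim, simp add: zeta)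

  have "filterlim (\<lambda>\<theta>::real. pi / (4 * sin \<theta>)) at_top (at_right 0)"
    by real_asymp
  then have "filterlim (\<lambda>x. pi / (4 * sin (angle x))) at_top at_top"
    using angle_at_right_0 by (rule filterlim_compose)
  then have "filterlim (\<lambda>x. (\<kappa> - M x) * (pi / (4 * sin (angle x)))) at_bot at_top"
    using m by (intro filterlim_tendsto_neg_mult_at_bot[OF tendsto_diff[OF tendsto_const M_top]]) auto
  moreover have "\<forall>\<^sub>F x in at_top. (\<kappa> - M x) * (pi / (4 * sin (angle x))) = zeta x"
    using eventually_gt_at_top[of 0] by eventually_elim (simp add: zeta)
  ultimately have 3: "filterlim zeta at_bot at_top"
    by (simp only: filterlim_cong[OF refl refl])

  have "\<exists>x0>0. M x0 = \<kappa>"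
  proof -
    have "0 < \<kappa>" by (simp add: \<kappa>_def)
    then have "\<forall>\<^sub>F x in at_right 0. 0 < x \<and> M x < \<kappa>"
      by (intro eventually_conj eventually_at_right_less order_tendstoD(2)[OF M_0])
    then obtain a where a: "0 < a" "M a < \<kappa>"
      using eventually_happens'[OF trivial_limit_at_right_real] by blast
    have "\<forall>\<^sub>F x in at_top. a < x \<and> \<kappa> < M x"
      by (intro eventually_conj eventually_gt_at_top order_tendstoD(1)[OF M_top m])
    then obtain b where b: "a < b" "\<kappa> < M b"
      using eventually_happens'[OF trivial_limit_at_top_linorder] by blast
    have "continuous_on {a..b} M"
      using M_cont by (rule continuous_on_subset) (use a in auto)
    then obtain x0 where "a \<le> x0" "M x0 = \<kappa>"
      using IVT'[of M a \<kappa> b] a b by auto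
    then show ?thesis
      using a(1) by (intro exI[of _ x0]) simp
  qed
  then obtain x0 where x0: "0 < x0" "M x0 = \<kappa>" by blast
  have "zeta x = 0 \<longleftrightarrow> x = x0" if "0 < x" for x
  proof -
    have "zeta x = 0 \<longleftrightarrow> M x = \<kappa>"
      using zeta[OF that] sin_pos[OF that] by auto
    also have "\<dots> \<longleftrightarrow> x = x0"
      using M_less[of x x0] M_less[of x0 x] x0 that by (cases x x0 rule: linorder_cases) auto
    finally show ?thesis .
  qed
  then have "\<exists>!x0. x0 \<in> {0<..} \<and> (\<forall>x\<in>{0<..}. zeta x = 0 \<longleftrightarrow> x = x0)"
    using x0(1) by (intro ex1I[of _ x0]) auto
  with 1 2 3 show ?thesis by blast
qed

end
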